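(* Let $d$ be a positive integer. Then a polynomial $P \in \mathbb{R}[X]$ belongs to $\mathscr{E}_d$ if and only if it has the form $$P(X) = \binom{X + d}{d} f(X + d) - \binom{X}{d} f(X)$$ for some $f \in \mathbb{R}[X]$. Besides, if $P$ has this form for a given $f \in \mathbb{R}[X]$, then for every natural number $n \in \mathbb{N}$ we have $$\sum_{1 \leq k \leq n/d} P(n - k d) = \binom{n}{d} f(n) .$$
   Context: Here $\mathbb{N} = \{0, 1, 2, \dots\}$, and $\binom{X}{m} := \frac{X(X-1)\cdots(X-m+1)}{m!} \in \mathbb{R}[X]$ for $m \in \mathbb{N}$. For a positive integer $d$, $\mathscr{E}_d$ denotes the set (an $\mathbb{R}$-linear subspace of $\mathbb{R}[X]$) of all polynomials $P \in \mathbb{R}[X]$ for which the sum $P(n) + P(n-d) + P(n-2d) + \cdots := \sum_{0 \leq k \leq n/d} P(n - k d)$ (the sum over integers $k \ge 0$ with $n - kd \geq 0$) is polynomial in $n \in \mathbb{N}$, i.e. there exists $S \in \mathbb{R}[X]$ such that this sum equals $S(n)$ for all $n \in \mathbb{N}$. *)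

theory Defs
  imports Complex_Main "HOL-Computational_Algebra.Polynomial"
begin

definition binom_poly :: "nat \<Rightarrow> real poly" where
  "binom_poly m = smult (1 / fact m) (\<Prod>i<m. [:- real i, 1:])"

lemma poly_binom_poly: "poly (binom_poly m) x = x gchoose m"
  by (simp add: binom_poly_def poly_prod gbinomial_prod_rev atLeast0LessThan)

lemma poly_binom_poly_of_nat: "poly (binom_poly m) (real n) = real (n choose m)"
  by (simp add: poly_binom_poly binomial_gbinomial)

text \<open>
  The polynomial \<open>Q(X + d)\<close>.
\<close>
definition shift_poly :: "nat \<Rightarrow> real poly \<Rightarrow> real poly" where
  "shift_poly d Q = pcompose Q [:real d, 1:]"

text \<open>
  The intended use is \<open>d > 0\<close>. The range \<open>0 \<le> k \<le> n/d\<close> over integers \<open>k\<close> is \<open>{0..n div d}\<close>;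
  the argument \<open>n - k d\<close> is formed in the reals, and is nonnegative on that range.
\<close>
definition E_set :: "nat \<Rightarrow> real poly set" where
  "E_set d = {P. \<exists>S :: real poly. \<forall>n :: nat.
     (\<Sum>k = 0..n div d. poly P (real n - real k * real d)) = poly S (real n)}"

end

theory Submission
  imports Defs
begin

text \<open>
  Writing \<open>T(n)\<close> for the sum over \<open>k \<ge> 1\<close>, one has \<open>P(X) = T(X + d) - T(X)\<close> and
  \<open>T(0) = \<dots> = T(d - 1) = 0\<close>, because for \<open>n < d\<close> the sum is empty; conversely a
  polynomial \<open>T\<close> with these two properties gives the sum by telescoping. The vanishing
  condition says exactly that \<open>T\<close> is a multiple of the binomial polynomial.
\<close>

lemma poly_shift_poly [simp]: "poly (shift_poly d Q) x = poly Q (x + real d)"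
  by (simp add: shift_poly_def poly_pcompose add.commute)

text \<open>A nonzero difference would have finitely many roots, yet characteristic 0 makes all
  naturals distinct roots. This turns identities between sums over naturals into polynomial
  identities.\<close>

lemma poly_eqI_nat:
  fixes p q :: "'a :: {idom, ring_char_0} poly"
  assumes "\<And>n :: nat. poly p (of_nat n) = poly q (of_nat n)"
  shows "p = q"
proof (rule ccontr)
  assume "p \<noteq> q"
  then have "finite {x. poly (p - q) x = 0}"
    by (intro poly_roots_finite) simp
  moreover have "range (of_nat :: nat \<Rightarrow> 'a) \<subseteq> {x. poly (p - q) x = 0}"
    using assms by auto
  ultimately have "finite (range (of_nat :: nat \<Rightarrow> 'a))"
    by (rule rev_finite_subset)
  then show False
    by (simp add: finite_image_iff inj_of_nat)
qed

text \<open>At \<open>of_nat m\<close> the factors for \<open>i < m\<close> are nonzero by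
  characteristic 0, so this root of \<open>T\<close> must be a root of the cofactor
  \<open>g\<close>, which supplies the next linear factor.\<close>

lemma prod_linear_dvd:
  fixes T :: "'a :: {idom, ring_char_0} poly"
  assumes "\<And>i. i < m \<Longrightarrow> poly T (of_nat i) = 0"
  shows "(\<Prod>i<m. [:- of_nat i, 1:]) dvd T"
  using assms
proof (induction m)
  case 0
  show ?case by simp
next
  case (Suc m)
  then obtain g where g: "T = (\<Prod>i<m. [:- of_nat i, 1:]) * g"
    by (auto elim: dvdE)
  have "poly T (of_nat m) = 0"
    using Suc.prems by blast
  then have "poly g (of_nat m) = 0"
    by (auto simp: g poly_prod)
  then have "[:- of_nat m, 1:] dvd g"
    by (simp add: poly_eq_0_iff_dvd)
  then show ?case
    by (simp add: g mult_dvd_mono del: mult_pCons_left mult_pCons_right)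
qed

lemma binom_poly_dvd:
  assumes "\<And>i. i < m \<Longrightarrow> poly T (real i) = 0"
  shows "binom_poly m dvd T"
  using prod_linear_dvd[of m T] assms by (simp add: binom_poly_def smult_dvd_iff)

text \<open>Each summand is the difference of \<open>g\<close> at neighbouring points of the
  progression n, n - d, n - 2d, ..., whose last point is \<open>n mod d\<close>.\<close>

lemma sum_telescope_residue:
  fixes P g :: "real poly"
  assumes P: "P = shift_poly d g - g"
  shows "(\<Sum>k = 1..n div d. poly P (real n - real k * real d))
           = poly g (real n) - poly g (real (n mod d))"
proof -
  have "(\<Sum>k = 1..n div d. poly P (real n - real k * real d))
      = (\<Sum>k<n div d. poly g (real n - real k * real d) - poly g (real n - real (Suc k) * real d))"
    by (simp add: P sum.atLeast1_atMost_eq algebra_simps del: sum_subtractf)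
  also have "\<dots> = poly g (real n) - poly g (real n - real (n div d) * real d)"
    by (subst sum_lessThan_telescope') simp
  also have "real n - real (n div d) * real d = real (n mod d)"
    by (metis add_diff_cancel_left' div_mult_mod_eq of_nat_add of_nat_mult)
  finally show ?thesis .
qed

lemma sum_eq_binom_poly_mult:
  assumes "d > 0"
    and "P = shift_poly d (binom_poly d) * shift_poly d f - binom_poly d * f"
  shows "(\<Sum>k = 1..n div d. poly P (real n - real k * real d))
           = poly (binom_poly d) (real n) * poly f (real n)"
proof -
  have "P = shift_poly d (binom_poly d * f) - binom_poly d * f"
    using assms(2) by (simp add: shift_poly_def pcompose_mult)
  \<comment> \<open>The boundary term vanishes: \<open>n mod d < d\<close>, so the binomial
    coefficient \<open>n mod d choose d\<close> is 0.\<close>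
  from sum_telescope_residue[OF this, of n] show ?thesis
    using \<open>d > 0\<close> by (simp add: poly_binom_poly_of_nat)
qed

lemma sum_atLeast0_eq:
  "(\<Sum>k = 0..n div d. poly P (real n - real k * real d))
     = poly P (real n) + (\<Sum>k = 1..n div d. poly P (real n - real k * real d))"
  by (simp add: sum.atLeast_Suc_atMost)

lemma E_set_imp_ex:
  assumes "d > 0" and "P \<in> E_set d"
  shows "\<exists>f. P = shift_poly d (binom_poly d) * shift_poly d f - binom_poly d * f"
proof -
  obtain S where S: "\<And>n. (\<Sum>k = 0..n div d. poly P (real n - real k * real d)) = poly S (real n)"
    using assms(2) by (auto simp: E_set_def)
  have T: "poly (S - P) (real n) = (\<Sum>k = 1..n div d. poly P (real n - real k * real d))" for n
    using S[of n] sum_atLeast0_eq[of P n d] by simp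
  \<comment> \<open>\<open>S - P\<close> is the sum without its term at k = 0. Passing from n to n +
    d adds one term, and reindexing k by one gives back the full sum at n.\<close>
  have "shift_poly d (S - P) = S"
  proof (rule poly_eqI_nat)
    fix n :: nat
    have "poly (S - P) (real (n + d))
        = (\<Sum>k = 1..Suc (n div d). poly P (real (n + d) - real k * real d))"
      using T[of "n + d"] \<open>d > 0\<close> by simp
    also have "\<dots> = (\<Sum>k = 0..n div d. poly P (real n - real k * real d))"
      by (simp only: One_nat_def sum.shift_bounds_cl_Suc_ivl) (simp add: algebra_simps)
    finally show "poly (shift_poly d (S - P)) (of_nat n) = poly S (of_nat n)"
      by (simp add: S)
  qed
  then have P: "P = shift_poly d (S - P) - (S - P)"
    by simp
  have "binom_poly d dvd S - P"
    \<comment> \<open>For \<open>i < d\<close> the value of \<open>S - P\<close> at i is a sum over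
      the empty range \<open>1..i div d\<close>.\<close>
    by (rule binom_poly_dvd) (simp only: T, simp)
  then obtain f where "S - P = binom_poly d * f"
    by (elim dvdE)
  with P have "P = shift_poly d (binom_poly d * f) - binom_poly d * f"
    by simp
  then show ?thesis
    by (auto simp: shift_poly_def pcompose_mult)
qed

theorem theorem2p1:
  fixes d :: nat and P :: "real poly"
  assumes "d > 0"
  shows "(P \<in> E_set d \<longleftrightarrow>
            (\<exists>f :: real poly.
               P = shift_poly d (binom_poly d) * shift_poly d f - binom_poly d * f))
       \<and> (\<forall>f :: real poly.
            P = shift_poly d (binom_poly d) * shift_poly d f - binom_poly d * f \<longrightarrow>
            (\<forall>n :: nat. (\<Sum>k = 1..n div d. poly P (real n - real k * real d))
                          = poly (binom_poly d) (real n) * poly f (real n)))"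
proof (intro conjI iffI allI impI)
  assume "P \<in> E_set d"
  then show "\<exists>f. P = shift_poly d (binom_poly d) * shift_poly d f - binom_poly d * f"
    by (rule E_set_imp_ex[OF assms])
next
  assume "\<exists>f. P = shift_poly d (binom_poly d) * shift_poly d f - binom_poly d * f"
  then obtain f where f: "P = shift_poly d (binom_poly d) * shift_poly d f - binom_poly d * f" ..
  \<comment> \<open>The witness for \<open>E_set\<close> is the term at k = 0, namely
    \<open>P\<close>, plus the closed form of the remaining sum.\<close>
  have "(\<Sum>k = 0..n div d. poly P (real n - real k * real d))
      = poly (P + binom_poly d * f) (real n)" for n
    by (simp only: sum_atLeast0_eq sum_eq_binom_poly_mult[OF assms f] poly_add poly_mult)
  then show "P \<in> E_set d"
    unfolding E_set_def by blast
qed (rule sum_eq_binom_poly_mult[OF assms])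

end
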